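(* For every integer $n\ge 3$ there exists a continuous map $f\colon S^{n-1}\to S^n$ such that: (i) the singular set $S(f)=\{x\in S^{n-1} \mid f^{-1}(f(x))\neq\{x\}\}$ is countable and dense in $S^{n-1}$ (hence $0$-dimensional and not closed in $S^{n-1}$); and (ii) $f$ can be approximated by an embedding, i.e. for every $\varepsilon>0$ there exists an embedding $g\colon S^{n-1}\to S^n$ such that $d(f(x),g(x))<\varepsilon$ for every $x\in S^{n-1}$.
   Context: $S^k$ denotes the standard $k$-dimensional sphere, and $d$ is the standard metric on $S^n$. For a continuous map $f\colon X\to Y$ between topological spaces, the singular set of $f$ is $S(f)=\{x\in X\mid f^{-1}(f(x))\neq\{x\}\}$, i.e. the set of points of $X$ at which $f$ fails to be injective. An embedding is a topological embedding (a homeomorphism onto its image). A map that can be approximated arbitrarily closely by embeddings in the sense of (ii) is called a near-embedding. *)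

theory Defs
  imports "HOL-Analysis.Analysis"
begin

text \<open>
  The sphere of dimension \<open>k\<close> is the unit sphere of \<open>real ^ 'd\<close> with \<open>CARD('d) = k + 1\<close>, and
  its metric is the restriction of the Euclidean distance. The geodesic distance is \<open>2 * arcsin (dist x y / 2)\<close>,
  so uniform approximation means the same for both metrics.
\<close>

definition singular_set :: "'a set \<Rightarrow> ('a \<Rightarrow> 'b) \<Rightarrow> 'a set" where
  "singular_set X f = {x \<in> X. X \<inter> f -` {f x} \<noteq> {x}}"

end

theory Submission
  imports Defs
begin

text \<open>
  Work in the \<open>n\<close>-dimensional space containing the sphere of dimension \<open>n - 1\<close>. A chord of that
  sphere can be collapsed to a point by a map that is the identity off a small ball, injective except
  on the chord, and a uniform limit of injective continuous maps. Choose successively chords whose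
  ends are dense in the sphere, the ball around each new chord being disjoint from all earlier chords,
  and compose the collapses with the new one innermost. The limit exists, it is again a uniform limit of
  injective maps, and its only nontrivial fibres are the chords. A chord meets the sphere exactly in
  its two ends, so the restriction to the sphere has the ends of the chords as its singular set.
  Finally the target space is embedded in the \<open>n\<close>-sphere as the complement of a point.
\<close>

section \<open>Collapsing an interval of the real line\<close>

text \<open>For \<open>a > 0\<close>, the odd piecewise linear function that vanishes on [-a, a],
  has slope 2 between \<open>a\<close> and \<open>2 * a\<close> in absolute value, and is the
  identity beyond. The two summands serve the two half-lines.\<close>

definition squash :: "real \<Rightarrow> real \<Rightarrow> real" where
  "squash a s = max 0 (min s (2 * s - 2 * a)) + min 0 (max s (2 * s + 2 * a))"

lemma squash_mono: "s \<le> s' \<Longrightarrow> squash a s \<le> squash a s'"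
  unfolding squash_def by (intro add_mono max.mono min.mono) auto

lemma squash_eq_iff:
  assumes "a > 0"
  shows "squash a s = squash a s' \<longleftrightarrow> s = s' \<or> \<bar>s\<bar> \<le> a \<and> \<bar>s'\<bar> \<le> a"
  using assms unfolding squash_def max_def min_def by (smt (verit))

lemma squash_far: "a > 0 \<Longrightarrow> \<bar>s\<bar> \<ge> 2 * a \<Longrightarrow> squash a s = s"
  unfolding squash_def max_def min_def by (smt (verit))

lemma squash_displacement: "a > 0 \<Longrightarrow> \<bar>squash a s - s\<bar> \<le> a"
  unfolding squash_def max_def min_def by (smt (verit))

lemma squash_slope:
  assumes "a > 0" "s \<le> s'"
  shows "squash a s' - squash a s \<le> 2 * (s' - s)"
proof -
  \<comment> \<open>Each summand sees only the positive or the negative part of its argument and has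
    slope at most 2 in it; the two parts add up to the argument.\<close>
  have "max 0 (min s' (2 * s' - 2 * a)) - max 0 (min s (2 * s - 2 * a)) \<le> 2 * (max 0 s' - max 0 s)"
    using assms by (simp add: max_def min_def)
  moreover have "min 0 (max s' (2 * s' + 2 * a)) - min 0 (max s (2 * s + 2 * a)) \<le> 2 * (min 0 s' - min 0 s)"
    using assms by (simp add: max_def min_def)
  moreover have "max 0 s + min 0 s = s" "max 0 s' + min 0 s' = s'"
    by (simp_all add: max_def min_def)
  ultimately show ?thesis
    unfolding squash_def by argo
qed

text \<open>All slopes of \<open>squash a\<close> lie between 0 and 2, so those of its difference
  from the identity lie between -1 and 1.\<close>

lemma squash_displacement_Lipschitz:
  assumes "a > 0"
  shows "\<bar>(squash a s - s) - (squash a s' - s')\<bar> \<le> \<bar>s - s'\<bar>"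
  using squash_slope[OF assms, of s s'] squash_slope[OF assms, of s' s]
    squash_mono[of s s' a] squash_mono[of s' s a]
  by (cases "s \<le> s'") simp_all

section \<open>Collapsing a segment in an inner product space\<close>

text \<open>For a unit vector \<open>e\<close>, the orthogonal projection onto the hyperplane
  perpendicular to \<open>e\<close>.\<close>

definition offaxis :: "'a::real_inner \<Rightarrow> 'a \<Rightarrow> 'a" where
  "offaxis e v = v - (v \<bullet> e) *\<^sub>R e"

lemma norm_offaxis:
  assumes "norm e = 1"
  shows "(norm (offaxis e v))\<^sup>2 = (norm v)\<^sup>2 - (v \<bullet> e)\<^sup>2"
proof -
  have "e \<bullet> e = 1"
    using assms by (simp add: norm_eq_1)
  then show ?thesis
    unfolding offaxis_def power2_norm_eq_inner
    by (simp add: inner_diff_left inner_diff_right inner_commute power2_eq_square algebra_simps)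
qed

lemma norm_offaxis_le: "norm e = 1 \<Longrightarrow> norm (offaxis e v) \<le> norm v"
  by (rule power2_le_imp_le) (simp_all add: norm_offaxis)

lemma offaxis_diff: "offaxis e (u - v) = offaxis e u - offaxis e v"
  by (simp add: offaxis_def algebra_simps)

lemma offaxis_add_axis: "norm e = 1 \<Longrightarrow> offaxis e (v + s *\<^sub>R e) = offaxis e v"
  by (simp add: offaxis_def algebra_simps norm_eq_1)

text \<open>For a unit vector \<open>e\<close>, the straight segment with midpoint \<open>m\<close>,
  direction \<open>e\<close> and half-length \<open>a\<close>, in the axial and off-axis coordinates
  that \<open>pinch\<close> works with.\<close>

definition segment :: "real \<Rightarrow> 'a::real_inner \<Rightarrow> 'a \<Rightarrow> 'a set" where
  "segment a m e = {x. offaxis e (x - m) = 0 \<and> \<bar>(x - m) \<bullet> e\<bar> \<le> a}"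

text \<open>Each line parallel to \<open>e\<close> is moved into itself, by a map that interpolates between
  \<open>squash a\<close> on the axis and the identity at distance \<open>a\<close> from it. Bounding the interpolation
  parameter below by \<open>t > 0\<close> makes the map injective.\<close>

definition damping :: "real \<Rightarrow> real \<Rightarrow> real" where
  "damping t r = 1 - max t (min 1 r)"

lemma damping_bounds: "0 \<le> t \<Longrightarrow> t \<le> 1 \<Longrightarrow> 0 \<le> damping t r \<and> damping t r \<le> 1"
  by (auto simp: damping_def)

lemma damping_Lipschitz: "\<bar>damping t r - damping t r'\<bar> \<le> \<bar>r - r'\<bar>"
  by (auto simp: damping_def max_def min_def)

lemma damping_approx: "0 \<le> t \<Longrightarrow> t \<le> 1 \<Longrightarrow> 0 \<le> r \<Longrightarrow> \<bar>damping t r - damping 0 r\<bar> \<le> t"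
  by (auto simp: damping_def max_def min_def)

definition pinch :: "real \<Rightarrow> 'a::real_inner \<Rightarrow> 'a \<Rightarrow> real \<Rightarrow> 'a \<Rightarrow> 'a" where
  "pinch a m e t x = x + (damping t (norm (offaxis e (x - m)) / a)
     * (squash a ((x - m) \<bullet> e) - (x - m) \<bullet> e)) *\<^sub>R e"

lemma segment_subset_cball:
  assumes "norm e = 1"
  shows "segment a m e \<subseteq> cball m a"
proof
  fix x assume x: "x \<in> segment a m e"
  then have "(norm (x - m))\<^sup>2 = ((x - m) \<bullet> e)\<^sup>2"
    using norm_offaxis[OF assms, of "x - m"] by (simp add: segment_def)
  then have "norm (x - m) = \<bar>(x - m) \<bullet> e\<bar>"
    by (metis abs_norm_cancel power2_eq_iff abs_minus_cancel)
  then show "x \<in> cball m a"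
    using x by (simp add: segment_def dist_norm norm_minus_commute)
qed

lemma segment_closed: "closed (segment a m e)"
  unfolding segment_def offaxis_def
  by (intro closed_Collect_conj closed_Collect_eq closed_Collect_le continuous_intros)

lemma pinch_displacement:
  assumes "a > 0" "norm e = 1" "0 \<le> t" "t \<le> 1"
  shows "dist (pinch a m e t x) x \<le> a"
proof -
  define A where "A = damping t (norm (offaxis e (x - m)) / a)"
  define B where "B = squash a ((x - m) \<bullet> e) - (x - m) \<bullet> e"
  have "\<bar>A\<bar> * \<bar>B\<bar> \<le> 1 * a"
    unfolding A_def B_def using damping_bounds[OF assms(3,4)] assms(1)
    by (intro mult_mono squash_displacement) auto
  moreover have "pinch a m e t x - x = (A * B) *\<^sub>R e"
    by (simp add: pinch_def A_def B_def)
  ultimately show ?thesis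
    using assms(2) by (simp add: dist_norm abs_mult)
qed

lemma pinch_approx:
  assumes "a > 0" "norm e = 1" "0 \<le> t" "t \<le> 1"
  shows "dist (pinch a m e t x) (pinch a m e 0 x) \<le> t * a"
proof -
  define r where "r = norm (offaxis e (x - m)) / a"
  define B where "B = squash a ((x - m) \<bullet> e) - (x - m) \<bullet> e"
  have "0 \<le> r"
    using assms(1) by (simp add: r_def)
  then have "\<bar>damping t r - damping 0 r\<bar> * \<bar>B\<bar> \<le> t * a"
    unfolding B_def using assms(1,3,4)
    by (intro mult_mono squash_displacement damping_approx) auto
  moreover have "pinch a m e t x - pinch a m e 0 x = ((damping t r - damping 0 r) * B) *\<^sub>R e"
    unfolding pinch_def r_def[symmetric] B_def[symmetric]
    by (simp add: algebra_simps)
  ultimately show ?thesis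
    using assms(2) by (simp add: dist_norm abs_mult)
qed

text \<open>The displacement along \<open>e\<close> is a product: one factor is at most 1 and
  (1/a)-Lipschitz, the other at most \<open>a\<close> and 1-Lipschitz. The product is 2-Lipschitz
  whatever \<open>a\<close> is, and the identity contributes 1.\<close>

lemma pinch_Lipschitz:
  assumes "a > 0" "norm e = 1" "0 \<le> t" "t \<le> 1"
  shows "dist (pinch a m e t x) (pinch a m e t y) \<le> 3 * dist x y"
proof -
  define A where "A x = damping t (norm (offaxis e (x - m)) / a)" for x
  define B where "B x = squash a ((x - m) \<bullet> e) - (x - m) \<bullet> e" for x
  have B: "\<bar>B x - B y\<bar> \<le> norm (x - y)"
  proof -
    have "\<bar>B x - B y\<bar> \<le> \<bar>(x - m) \<bullet> e - (y - m) \<bullet> e\<bar>"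
      unfolding B_def by (rule squash_displacement_Lipschitz[OF assms(1)])
    also have "\<dots> = \<bar>(x - y) \<bullet> e\<bar>"
      by (simp add: inner_diff_left)
    also have "\<dots> \<le> norm (x - y)"
      using Cauchy_Schwarz_ineq2[of "x - y" e] assms(2) by simp
    finally show ?thesis .
  qed
  have A: "\<bar>A x - A y\<bar> \<le> norm (x - y) / a"
  proof -
    have "\<bar>A x - A y\<bar> \<le> \<bar>norm (offaxis e (x - m)) / a - norm (offaxis e (y - m)) / a\<bar>"
      unfolding A_def by (rule damping_Lipschitz)
    also have "\<dots> = \<bar>norm (offaxis e (x - m)) - norm (offaxis e (y - m))\<bar> / a"
      using assms(1) by (simp only: abs_divide abs_of_pos flip: diff_divide_distrib)
    also have "\<dots> \<le> norm (offaxis e (x - m) - offaxis e (y - m)) / a"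
      using assms(1) norm_triangle_ineq3 by (intro divide_right_mono) auto
    also have "offaxis e (x - m) - offaxis e (y - m) = offaxis e (x - y)"
      by (simp flip: offaxis_diff)
    also have "norm \<dots> / a \<le> norm (x - y) / a"
      using assms(1) norm_offaxis_le[OF assms(2)] by (intro divide_right_mono) auto
    finally show ?thesis .
  qed
  have "A x * B x - A y * B y = A x * (B x - B y) + (A x - A y) * B y"
    by (simp add: algebra_simps)
  also have "\<bar>\<dots>\<bar> \<le> \<bar>A x\<bar> * \<bar>B x - B y\<bar> + \<bar>A x - A y\<bar> * \<bar>B y\<bar>"
    by (rule order_trans[OF abs_triangle_ineq]) (simp only: abs_mult order_refl)
  also have "\<dots> \<le> 1 * norm (x - y) + norm (x - y) / a * a"
  proof (intro add_mono mult_mono A B)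
    show "\<bar>A x\<bar> \<le> 1"
      using damping_bounds[OF assms(3,4)] by (simp add: A_def)
    show "\<bar>B y\<bar> \<le> a"
      unfolding B_def by (rule squash_displacement[OF assms(1)])
  qed (use assms(1) in auto)
  finally have *: "\<bar>A x * B x - A y * B y\<bar> \<le> 2 * norm (x - y)"
    using assms(1) by simp
  have "pinch a m e t x - pinch a m e t y = (x - y) + (A x * B x - A y * B y) *\<^sub>R e"
    unfolding pinch_def A_def[symmetric] B_def[symmetric] by (simp add: algebra_simps)
  then have "norm (pinch a m e t x - pinch a m e t y)
      \<le> norm (x - y) + \<bar>A x * B x - A y * B y\<bar>"
    using assms(2) norm_triangle_ineq[of "x - y" "(A x * B x - A y * B y) *\<^sub>R e"] by simp
  with * show ?thesis
    by (simp add: dist_norm)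
qed

text \<open>At distance at least \<open>a\<close> from the axis the damping factor is 0. Closer to
  the axis, a point outside the ball has squared axial coordinate at least
  \<open>9 * a\<^sup>2 - a\<^sup>2\<close>, which exceeds \<open>(2 * a)\<^sup>2\<close>, and there
  \<open>squash a\<close> is the identity.\<close>

lemma pinch_far:
  assumes "a > 0" "norm e = 1" "t \<le> 1" "x \<notin> cball m (3 * a)"
  shows "pinch a m e t x = x"
proof (cases "norm (offaxis e (x - m)) \<ge> a")
  case True
  then have "1 \<le> norm (offaxis e (x - m)) / a"
    using assms by simp
  then show ?thesis
    using assms(3) by (simp add: pinch_def damping_def)
next
  case False
  have "(3 * a)\<^sup>2 \<le> (norm (x - m))\<^sup>2"
    using assms by (intro power_mono) (auto simp: dist_norm norm_minus_commute)
  moreover have "(norm (offaxis e (x - m)))\<^sup>2 \<le> a\<^sup>2"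
    using False by (intro power_mono) auto
  ultimately have "9 * a\<^sup>2 - ((x - m) \<bullet> e)\<^sup>2 \<le> a\<^sup>2"
    using norm_offaxis[OF assms(2), of "x - m"] by (simp add: power_mult_distrib)
  moreover have "(2 * a)\<^sup>2 = 4 * a\<^sup>2"
    by (simp add: power_mult_distrib)
  ultimately have "(2 * a)\<^sup>2 \<le> ((x - m) \<bullet> e)\<^sup>2"
    using zero_le_power2[of a] by linarith
  then have "\<bar>2 * a\<bar> \<le> \<bar>(x - m) \<bullet> e\<bar>"
    by (simp only: abs_le_square_iff)
  then have "squash a ((x - m) \<bullet> e) = (x - m) \<bullet> e"
    using assms by (intro squash_far) auto
  then show ?thesis
    by (simp add: pinch_def)
qed

text \<open>Off-axis components are preserved, so only points of one line parallel to
  \<open>e\<close> can be identified. On it the map is a convex combination of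
  \<open>squash a\<close> and the identity, strictly increasing unless \<open>squash a\<close> has
  weight 1, which happens only on the axis with \<open>t = 0\<close>.\<close>

lemma pinch_eq_iff:
  assumes "a > 0" "norm e = 1" "0 \<le> t" "t \<le> 1"
  shows "pinch a m e t x = pinch a m e t y \<longleftrightarrow>
    x = y \<or> t = 0 \<and> x \<in> segment a m e \<and> y \<in> segment a m e"
proof -
  define D where "D v = damping t (norm v / a)" for v :: 'a
  define s where "s x = (x - m) \<bullet> e" for x
  define w where "w x = offaxis e (x - m)" for x
  have ee: "e \<bullet> e = 1"
    using assms(2) by (simp add: norm_eq_1)
  have decomp: "x = m + w x + s x *\<^sub>R e" for x
    by (simp add: offaxis_def w_def s_def)
  have pinch: "pinch a m e t x = x + (D (w x) * (squash a (s x) - s x)) *\<^sub>R e" for x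
    by (simp add: pinch_def D_def s_def w_def)
  have w_pinch: "w (pinch a m e t x) = w x" for x
    unfolding pinch w_def using offaxis_add_axis[OF assms(2), of "x - m"]
    by (simp add: add_diff_eq add.commute diff_add_eq)
  have s_pinch: "s (pinch a m e t x) = D (w x) * squash a (s x) + (1 - D (w x)) * s x" for x
    unfolding pinch using ee by (simp add: s_def algebra_simps)
  have eq: "pinch a m e t x = pinch a m e t y \<longleftrightarrow> w x = w y \<and>
      D (w x) * squash a (s x) + (1 - D (w x)) * s x = D (w x) * squash a (s y) + (1 - D (w x)) * s y"
    (is "_ \<longleftrightarrow> _ \<and> ?lin x y")
    by (metis w_pinch s_pinch decomp)
  have D: "0 \<le> D v" "D v \<le> 1" for v
    using damping_bounds[OF assms(3,4)] by (auto simp: D_def)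
  have strict: "d * squash a r + (1 - d) * r < d * squash a r' + (1 - d) * r'"
    if "0 \<le> d" "d < 1" "r < r'" for d r r'
  proof (rule add_le_less_mono)
    show "d * squash a r \<le> d * squash a r'"
      using that squash_mono by (intro mult_left_mono) auto
    show "(1 - d) * r < (1 - d) * r'"
      using that by (intro mult_strict_left_mono) auto
  qed
  have inj: "?lin x y \<longleftrightarrow> s x = s y" if "D (w x) < 1"
    using strict[OF D(1) that, of "s x" "s y"] strict[OF D(1) that, of "s y" "s x"]
    by (metis less_irrefl linorder_neqE)
  show ?thesis
  proof (cases "D (w x) < 1")
    case True
    have "\<not> (t = 0 \<and> x \<in> segment a m e)"
      using True by (auto simp: D_def damping_def segment_def w_def)
    moreover have "pinch a m e t x = pinch a m e t y \<longleftrightarrow> x = y"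
      unfolding eq inj[OF True] by (metis decomp)
    ultimately show ?thesis
      by blast
  next
    case False
    then have "D (w x) = 1"
      using D(2)[of "w x"] by simp
    then have "max t (min 1 (norm (w x) / a)) = 0"
      by (simp add: D_def damping_def)
    then have "t = 0" "min 1 (norm (w x) / a) \<le> 0"
      using assms(3) by (auto simp: max_def split: if_splits)
    then have t: "t = 0" and w: "w x = 0"
      using assms(1) by (auto simp: min_def divide_le_0_iff split: if_splits)
    have "pinch a m e t x = pinch a m e t y \<longleftrightarrow> w x = w y \<and> squash a (s x) = squash a (s y)"
      unfolding eq using \<open>D (w x) = 1\<close> by simp
    also have "\<dots> \<longleftrightarrow> w x = w y \<and> (s x = s y \<or> \<bar>s x\<bar> \<le> a \<and> \<bar>s y\<bar> \<le> a)"
      using squash_eq_iff[OF assms(1)] by simp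
    also have "\<dots> \<longleftrightarrow> x = y \<or> x \<in> segment a m e \<and> y \<in> segment a m e"
      unfolding segment_def w_def[symmetric] s_def[symmetric] mem_Collect_eq using w decomp by metis
    finally show ?thesis
      using t by simp
  qed
qed

section \<open>Infinite compositions of collapses and their fibres\<close>

text \<open>A pinch is 3-Lipschitz, so that radii below \<open>(1/6) ^ Suc i\<close> make the corrections summable.\<close>

locale pinch_sequence =
  fixes a :: "nat \<Rightarrow> real" and m e :: "nat \<Rightarrow> 'a::euclidean_space"
  assumes radius_pos: "0 < a i"
    and radius_le: "a i \<le> (1 / 6) ^ Suc i"
    and norm_axis: "norm (e i) = 1"
    and support_disjoint: "j < i \<Longrightarrow> cball (m i) (3 * a i) \<inter> segment (a j) (m j) (e j) = {}"
begin

abbreviation chord :: "nat \<Rightarrow> 'a set" where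
  "chord i \<equiv> segment (a i) (m i) (e i)"

abbreviation collapse :: "nat \<Rightarrow> 'a \<Rightarrow> 'a" where
  "collapse i \<equiv> pinch (a i) (m i) (e i) 0"

text \<open>The starting index \<open>k\<close> is kept so that a composition splits into its outer
  maps and a tail of the same kind.\<close>

primrec stage :: "nat \<Rightarrow> nat \<Rightarrow> 'a \<Rightarrow> 'a" where
  "stage k 0 = id"
| "stage k (Suc n) = stage k n \<circ> collapse (k + n)"

definition limit_map :: "nat \<Rightarrow> 'a \<Rightarrow> 'a" where
  "limit_map k x = lim (\<lambda>n. stage k n x)"

lemma stage_add: "stage k (n + l) = stage k n \<circ> stage (k + n) l"
  by (induction l) (simp_all add: comp_assoc add.assoc)

lemma stage_Lipschitz: "dist (stage k n x) (stage k n y) \<le> 3 ^ n * dist x y"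
proof (induction n arbitrary: x y)
  case (Suc n)
  have "dist (stage k (Suc n) x) (stage k (Suc n) y)
      \<le> 3 ^ n * dist (collapse (k + n) x) (collapse (k + n) y)"
    using Suc by simp
  also have "\<dots> \<le> 3 ^ n * (3 * dist x y)"
    using radius_pos norm_axis by (intro mult_left_mono pinch_Lipschitz) auto
  finally show ?case
    by simp
qed auto

lemma stage_continuous: "continuous_on S (stage k n)"
  using stage_Lipschitz by (intro lipschitz_on_continuous_on[of "3 ^ n"] lipschitz_onI) auto

text \<open>The new innermost collapse moves a point by at most
  \<open>(1 / 6) ^ Suc (k + n)\<close>, and the outer maps stretch this by at most
  \<open>3 ^ n\<close>. Relaxing the latter to \<open>3 ^ Suc (k + n)\<close> makes the exponents
  match.\<close>

lemma stage_step: "dist (stage k n x) (stage k (Suc n) x) \<le> (1 / 2) ^ Suc (k + n)"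
proof -
  have "dist (stage k n x) (stage k (Suc n) x) \<le> 3 ^ n * dist x (collapse (k + n) x)"
    using stage_Lipschitz[of k n x] by simp
  also have "\<dots> \<le> 3 ^ Suc (k + n) * (1 / 6) ^ Suc (k + n)"
  proof (intro mult_mono)
    show "dist x (collapse (k + n) x) \<le> (1 / 6) ^ Suc (k + n)"
      using pinch_displacement[of "a (k + n)" "e (k + n)" 0 "m (k + n)" x]
        radius_pos norm_axis radius_le[of "k + n"] by (simp add: dist_commute)
    show "(3 :: real) ^ n \<le> 3 ^ Suc (k + n)"
      by (rule power_increasing) auto
  qed auto
  also have "\<dots> = (1 / 2) ^ Suc (k + n)"
    by (simp only: flip: power_mult_distrib) simp
  finally show ?thesis .
qed

text \<open>The step bounds form a geometric series; keeping its exact partial sum on the right lets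
  the induction on \<open>l\<close> close.\<close>

lemma stage_dist: "dist (stage k n x) (stage k (n + l) x) \<le> (1 / 2) ^ (k + n) - (1 / 2) ^ (k + n + l)"
proof (induction l)
  case (Suc l)
  have "dist (stage k n x) (stage k (n + Suc l) x)
      \<le> dist (stage k n x) (stage k (n + l) x) + dist (stage k (n + l) x) (stage k (Suc (n + l)) x)"
    unfolding add_Suc_right by (rule dist_triangle)
  also have "\<dots> \<le> (1 / 2) ^ (k + n) - (1 / 2) ^ (k + n + l) + (1 / 2) ^ Suc (k + (n + l))"
    by (intro add_mono Suc.IH stage_step)
  also have "\<dots> = (1 / 2) ^ (k + n) - (1 / 2) ^ (k + n + Suc l)"
    by (simp add: add.assoc)
  finally show ?case .
qed auto

lemma stage_tendsto: "(\<lambda>n. stage k n x) \<longlonglongrightarrow> limit_map k x"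
proof -
  have "Cauchy (\<lambda>n. stage k n x)"
  proof (rule metric_CauchyI)
    fix \<epsilon> :: real assume "\<epsilon> > 0"
    then obtain N where N: "(1 / 2) ^ N < \<epsilon> / 2"
      using real_arch_pow_inv[of "\<epsilon> / 2" "1 / 2"] by auto
    have *: "dist (stage k N x) (stage k n x) < \<epsilon> / 2" if "n \<ge> N" for n
    proof -
      have "dist (stage k N x) (stage k (N + (n - N)) x) \<le> (1 / 2) ^ (k + N) - (1 / 2) ^ (k + N + (n - N))"
        by (rule stage_dist)
      also have "\<dots> \<le> (1 / 2) ^ (k + N)"
        by simp
      also have "\<dots> \<le> (1 / 2 :: real) ^ N"
        by (intro power_decreasing) auto
      finally show ?thesis
        using N that by simp
    qed
    show "\<exists>M. \<forall>i\<ge>M. \<forall>j\<ge>M. dist (stage k i x) (stage k j x) < \<epsilon>"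
      using dist_triangle_half_r[OF * *] by blast
  qed
  then show ?thesis
    unfolding limit_map_def by (simp add: Cauchy_convergent_iff convergent_LIMSEQ_iff)
qed

lemma dist_stage_limit_map: "dist (stage k n x) (limit_map k x) \<le> (1 / 2) ^ (k + n)"
proof (rule LIMSEQ_le_const2)
  show "(\<lambda>l. dist (stage k n x) (stage k l x)) \<longlonglongrightarrow> dist (stage k n x) (limit_map k x)"
    by (intro tendsto_intros stage_tendsto)
  have "dist (stage k n x) (stage k l x) \<le> (1 / 2) ^ (k + n)" if "l \<ge> n" for l
    using stage_dist[of k n x "l - n"] that by (smt (verit) le_add_diff_inverse zero_le_power divide_nonneg_nonneg)
  then show "\<exists>N. \<forall>l\<ge>N. dist (stage k n x) (stage k l x) \<le> (1 / 2) ^ (k + n)"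
    by blast
qed

text \<open>Continuity lets the outer \<open>n\<close> maps pass through the limit. Fibres of the
  limit are thereby governed by a finite stage applied after a tail close to the identity.\<close>

lemma limit_map_eq: "limit_map k x = stage k n (limit_map (k + n) x)"
proof (rule LIMSEQ_unique)
  show "(\<lambda>l. stage k (l + n) x) \<longlonglongrightarrow> limit_map k x"
    using stage_tendsto by (rule LIMSEQ_ignore_initial_segment)
  have "(\<lambda>l. stage k n (stage (k + n) l x)) \<longlonglongrightarrow> stage k n (limit_map (k + n) x)"
    using stage_continuous[of UNIV k n] stage_tendsto
    by (intro continuous_on_tendsto_compose[of UNIV "stage k n"]) auto
  then show "(\<lambda>l. stage k (l + n) x) \<longlonglongrightarrow> stage k n (limit_map (k + n) x)"
    by (simp add: stage_add add.commute[of _ n])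
qed

lemma limit_map_continuous: "continuous_on S (limit_map k)"
proof (rule uniform_limit_theorem)
  show "uniform_limit S (stage k) (limit_map k) sequentially"
  proof (rule uniform_limitI)
    fix \<epsilon> :: real assume "\<epsilon> > 0"
    then obtain N where N: "(1 / 2) ^ N < \<epsilon>"
      using real_arch_pow_inv[of \<epsilon> "1 / 2"] by auto
    have "dist (stage k n x) (limit_map k x) < \<epsilon>" if "n \<ge> N" for n x
    proof -
      have "(1 / 2 :: real) ^ (k + n) \<le> (1 / 2) ^ N"
        using that by (intro power_decreasing) auto
      with N dist_stage_limit_map[of k n x] show ?thesis
        by linarith
    qed
    then show "\<forall>\<^sub>F n in sequentially. \<forall>x\<in>S. dist (stage k n x) (limit_map k x) < \<epsilon>"
      by (auto simp: eventually_sequentially)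
  qed
qed (auto simp: stage_continuous)

text \<open>The later collapse fixes the earlier chord pointwise, since its ball misses that chord.
  Conversely, if the image of \<open>x\<close> is on the earlier chord, it is fixed, so
  \<open>x\<close> and its image are mapped to the same point; as the image is not on
  \<open>chord i\<close>, the two coincide.\<close>

lemma collapse_mem_chord_iff:
  assumes "j < i"
  shows "collapse i x \<in> chord j \<longleftrightarrow> x \<in> chord j"
proof -
  have fixed: "collapse i y = y" if "y \<in> chord j" for y
    using support_disjoint[OF assms] that radius_pos norm_axis by (intro pinch_far) auto
  have "x \<in> chord j" if "collapse i x \<in> chord j"
  proof -
    have "collapse i (collapse i x) = collapse i x"
      using fixed that by blast
    moreover have "collapse i x \<notin> chord i"
    proof
      assume "collapse i x \<in> chord i"
      then have "collapse i x \<in> cball (m i) (3 * a i)"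
        using segment_subset_cball[OF norm_axis, of "a i" "m i" i] radius_pos[of i] by auto
      with that support_disjoint[OF assms] show False
        by blast
    qed
    ultimately have "collapse i x = x"
      using radius_pos[of i] norm_axis[of i] by (subst (asm) pinch_eq_iff) auto
    with that show ?thesis
      by simp
  qed
  with fixed show ?thesis
    by auto
qed

text \<open>The innermost collapse contributes its own chord, and pulling the earlier chords back
  through it leaves them unchanged.\<close>

lemma stage_eq_iff:
  "stage 0 k x = stage 0 k y \<longleftrightarrow> x = y \<or> (\<exists>j<k. x \<in> chord j \<and> y \<in> chord j)"
proof (induction k arbitrary: x y)
  case (Suc k)
  have "stage 0 (Suc k) x = stage 0 (Suc k) y \<longleftrightarrow>
      collapse k x = collapse k y \<or> (\<exists>j<k. collapse k x \<in> chord j \<and> collapse k y \<in> chord j)"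
    by (simp add: Suc)
  also have "\<dots> \<longleftrightarrow> (x = y \<or> x \<in> chord k \<and> y \<in> chord k) \<or> (\<exists>j<k. x \<in> chord j \<and> y \<in> chord j)"
    using radius_pos norm_axis by (simp add: pinch_eq_iff collapse_mem_chord_iff cong: conj_cong)
  finally show ?case
    by (auto simp: less_Suc_eq)
qed auto

text \<open>If \<open>x \<noteq> y\<close> have the same image, then for each large \<open>k\<close> the points \<open>limit_map k x\<close> and
  \<open>limit_map k y\<close> are distinct and lie on a common chord. They stay at a definite distance, and
  the chords shrink, so that one chord serves infinitely many \<open>k\<close> and contains \<open>x\<close> and \<open>y\<close>.\<close>

lemma limit_map_eq_iff:
  "limit_map 0 x = limit_map 0 y \<longleftrightarrow> x = y \<or> (\<exists>j. x \<in> chord j \<and> y \<in> chord j)"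
proof
  assume eq: "limit_map 0 x = limit_map 0 y"
  show "x = y \<or> (\<exists>j. x \<in> chord j \<and> y \<in> chord j)"
  proof (cases "x = y")
    case False
    define \<delta> where "\<delta> = dist x y"
    have "\<delta> > 0"
      using False by (simp add: \<delta>_def)
    \<comment> \<open>One \<open>N\<close> serves twice: the tails from index \<open>N\<close> on
      move points by less than \<open>\<delta> / 4\<close>, and a chord of half-length above
      \<open>\<delta> / 4\<close> has index below \<open>N\<close>.\<close>
    then obtain N where N: "(1 / 2) ^ N < \<delta> / 4"
      using real_arch_pow_inv[of "\<delta> / 4" "1 / 2"] by auto
    have near: "dist z (limit_map k z) \<le> (1 / 2) ^ k" for z k
      using dist_stage_limit_map[of k 0 z] by simp
    have ex: "\<exists>j<N. limit_map k x \<in> chord j \<and> limit_map k y \<in> chord j" if "k \<ge> N" for k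
    proof -
      have "(1 / 2 :: real) ^ k \<le> (1 / 2) ^ N"
        using that by (intro power_decreasing) auto
      then have "dist x (limit_map k x) < \<delta> / 4" "dist y (limit_map k y) < \<delta> / 4"
        using near[of x k] near[of y k] N by linarith+
      moreover have "\<delta> \<le> dist x (limit_map k x) + dist (limit_map k x) (limit_map k y) + dist y (limit_map k y)"
        using dist_triangle[of x y "limit_map k x"] dist_triangle2[of "limit_map k x" y "limit_map k y"]
        unfolding \<delta>_def by linarith
      ultimately have far: "dist (limit_map k x) (limit_map k y) > \<delta> / 2"
        by linarith
      have "stage 0 k (limit_map k x) = stage 0 k (limit_map k y)"
        using limit_map_eq[of 0 _ k] eq by simp
      then obtain j where j: "limit_map k x \<in> chord j" "limit_map k y \<in> chord j"
        using far \<open>\<delta> > 0\<close> unfolding stage_eq_iff by auto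
      have "dist (limit_map k x) (limit_map k y) \<le> 2 * a j"
      proof -
        have "dist (m j) (limit_map k x) \<le> a j" "dist (m j) (limit_map k y) \<le> a j"
          using j segment_subset_cball[OF norm_axis, of "a j" "m j" j] by auto
        then show ?thesis
          using dist_triangle3[of "limit_map k x" "limit_map k y" "m j"] by linarith
      qed
      with far have "\<delta> / 4 < a j"
        by linarith
      also have "a j \<le> (1 / 6) ^ Suc j"
        by (rule radius_le)
      also have "\<dots> \<le> (1 / 2) ^ Suc j"
        by (intro power_mono) auto
      also have "\<dots> \<le> (1 / 2) ^ j"
        by simp
      finally have "(1 / 2 :: real) ^ N < (1 / 2) ^ j"
        using N by linarith
      then have "j < N"
        by (simp add: power_strict_decreasing_iff)
      with j show ?thesis
        by blast
    qed
    then have "\<forall>k\<in>{N..}. \<exists>j\<in>{..<N}. limit_map k x \<in> chord j \<and> limit_map k y \<in> chord j"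
      by auto
    from pigeonhole_infinite_rel[OF infinite_Ici finite_lessThan this]
    obtain j where "infinite {k \<in> {N..}. limit_map k x \<in> chord j \<and> limit_map k y \<in> chord j}"
      by auto
    then have "infinite {k. limit_map k x \<in> chord j \<and> limit_map k y \<in> chord j}"
      by (rule contrapos_nn) (rule finite_subset, auto)
    then have freq: "\<exists>\<^sub>F k in sequentially. limit_map k x \<in> chord j \<and> limit_map k y \<in> chord j"
      by (simp add: frequently_cofinite flip: cofinite_eq_sequentially)
    have tendsto: "(\<lambda>k. limit_map k z) \<longlonglongrightarrow> z" for z
    proof (rule metric_tendsto_imp_tendsto)
      show "(\<lambda>k. (1 / 2) ^ k :: real) \<longlonglongrightarrow> 0"
        by (simp add: LIMSEQ_realpow_zero)
      show "\<forall>\<^sub>F k in sequentially. dist (limit_map k z) z \<le> dist ((1 / 2) ^ k :: real) 0"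
        using near by (auto simp: dist_commute)
    qed
    \<comment> \<open>Chords are closed, so membership along infinitely many \<open>k\<close> passes
      to the limit \<open>z\<close>.\<close>
    have "z \<in> chord j" if "\<exists>\<^sub>F k in sequentially. limit_map k z \<in> chord j" for z
    proof (rule ccontr)
      assume "z \<notin> chord j"
      then have "\<forall>\<^sub>F k in sequentially. limit_map k z \<in> - chord j"
        using tendsto[of z] segment_closed by (intro topological_tendstoD) auto
      with that show False
        by (simp add: frequently_def)
    qed
    moreover have "\<exists>\<^sub>F k in sequentially. limit_map k x \<in> chord j"
      and "\<exists>\<^sub>F k in sequentially. limit_map k y \<in> chord j"
      using freq by (simp_all add: frequently_mono[of "\<lambda>k. limit_map k x \<in> chord j \<and> limit_map k y \<in> chord j"])
    ultimately show ?thesis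
      by blast
  qed simp
next
  assume *: "x = y \<or> (\<exists>j. x \<in> chord j \<and> y \<in> chord j)"
  show "limit_map 0 x = limit_map 0 y"
  proof (cases "x = y")
    case False
    then obtain j where j: "x \<in> chord j" "y \<in> chord j"
      using * by blast
    \<comment> \<open>The shift by \<open>Suc j\<close> ensures that the collapse of chord
      \<open>j\<close> is among those composed.\<close>
    have "stage 0 (n + Suc j) x = stage 0 (n + Suc j) y" for n
      unfolding stage_eq_iff using j by (intro disjI2 exI[of _ j]) auto
    then have "(\<lambda>n. stage 0 (n + Suc j) x) \<longlonglongrightarrow> limit_map 0 y"
      using LIMSEQ_ignore_initial_segment[OF stage_tendsto[of 0 y], of "Suc j"] by simp
    moreover have "(\<lambda>n. stage 0 (n + Suc j) x) \<longlonglongrightarrow> limit_map 0 x"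
      by (rule LIMSEQ_ignore_initial_segment[OF stage_tendsto])
    ultimately show ?thesis
      by (rule LIMSEQ_unique[rotated])
  qed simp
qed

section \<open>Approximation by injective maps\<close>

text \<open>Each collapse is replaced by a pinch with a small positive parameter, which is
  injective.\<close>

lemma stage_injective_approx:
  assumes "\<epsilon> > 0"
  shows "\<exists>g. continuous_on UNIV g \<and> inj g \<and> (\<forall>x. dist (stage k n x) (g x) < \<epsilon>)"
  using assms
proof (induction n arbitrary: \<epsilon>)
  case 0
  then show ?case
    by (intro exI[of _ id]) (auto simp: continuous_on_id)
next
  case (Suc n)
  obtain g where g: "continuous_on UNIV g" "inj g" "\<And>x. dist (stage k n x) (g x) < \<epsilon> / 2"
    using Suc.IH[of "\<epsilon> / 2"] Suc.prems by auto
  let ?i = "k + n"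
  \<comment> \<open>The pinch differs from the collapse by at most \<open>t * a ?i\<close>, and the
    outer maps stretch this by at most \<open>3 ^ n\<close>; the choice keeps the result within
    \<open>\<epsilon> / 2\<close>.\<close>
  define t where "t = min 1 (\<epsilon> / (2 * 3 ^ n * a ?i))"
  define p where "p = pinch (a ?i) (m ?i) (e ?i) t"
  have t: "0 < t" "t \<le> 1" "3 ^ n * (t * a ?i) \<le> \<epsilon> / 2"
    using Suc.prems radius_pos[of ?i] by (auto simp: t_def field_simps min_def)
  have inj: "inj p"
    using t radius_pos norm_axis by (intro injI) (simp add: p_def pinch_eq_iff)
  have cont: "continuous_on UNIV p"
    unfolding p_def using t radius_pos norm_axis
    by (intro lipschitz_on_continuous_on[of 3] lipschitz_onI pinch_Lipschitz) auto
  have "dist (stage k (Suc n) x) ((g \<circ> p) x) < \<epsilon>" for x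
  proof -
    have "dist (stage k n (collapse ?i x)) (stage k n (p x)) \<le> 3 ^ n * dist (collapse ?i x) (p x)"
      by (rule stage_Lipschitz)
    also have "\<dots> \<le> 3 ^ n * (t * a ?i)"
      using pinch_approx[of "a ?i" "e ?i" t "m ?i" x] t radius_pos norm_axis
      by (intro mult_left_mono) (auto simp: p_def dist_commute)
    also have "\<dots> \<le> \<epsilon> / 2"
      by (rule t)
    finally show ?thesis
      using g(3)[of "p x"] dist_triangle[of "stage k n (collapse ?i x)" "g (p x)" "stage k n (p x)"]
      by simp
  qed
  moreover have "continuous_on UNIV (g \<circ> p)" "inj (g \<circ> p)"
    using continuous_on_compose[OF cont continuous_on_subset[OF g(1)]] g(2) inj
    by (simp_all add: inj_compose)
  ultimately show ?case
    by blast
qed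

lemma limit_map_injective_approx:
  assumes "\<epsilon> > 0"
  shows "\<exists>g. continuous_on UNIV g \<and> inj g \<and> (\<forall>x. dist (limit_map 0 x) (g x) < \<epsilon>)"
proof -
  obtain n where n: "(1 / 2) ^ n < \<epsilon> / 2"
    using real_arch_pow_inv[of "\<epsilon> / 2" "1 / 2"] assms by auto
  obtain g where g: "continuous_on UNIV g" "inj g" "\<And>x. dist (stage 0 n x) (g x) < \<epsilon> / 2"
    using stage_injective_approx[of "\<epsilon> / 2" 0 n] assms by auto
  have "dist (limit_map 0 x) (g x) < \<epsilon>" for x
    using g(3)[of x] n dist_stage_limit_map[of 0 n x] dist_triangle3[of "limit_map 0 x" "g x" "stage 0 n x"]
    by simp
  with g show ?thesis
    by blast
qed

end

section \<open>Countable spaces and embeddings of compact sets\<close>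

text \<open>Only countably many distances from \<open>x\<close> occur in \<open>S\<close>, so there
  are arbitrarily small radii that do not occur. For such a radius the open and the closed ball
  agree in \<open>S\<close>, which gives a clopen neighbourhood.\<close>

lemma countable_imp_dim_le_0:
  fixes S :: "'a::metric_space set"
  assumes "countable S"
  shows "top_of_set S dim_le 0"
  unfolding dimension_le_0_neighbourhood_base_of_clopen neighbourhood_base_of
proof (intro allI impI)
  fix W x
  assume W: "openin (top_of_set S) W \<and> x \<in> W"
  then obtain \<epsilon> where \<epsilon>: "\<epsilon> > 0" "\<And>y. y \<in> S \<Longrightarrow> dist y x < \<epsilon> \<Longrightarrow> y \<in> W"
    unfolding openin_euclidean_subtopology_iff by blast
  have "uncountable {0<..<\<epsilon>}"
    using \<epsilon>(1) by (simp add: uncountable_open_interval)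
  moreover have "countable (dist x ` S)"
    using assms by simp
  ultimately have "\<not> {0<..<\<epsilon>} \<subseteq> dist x ` S"
    using countable_subset by blast
  then obtain r where r: "0 < r" "r < \<epsilon>" "r \<notin> dist x ` S"
    by (meson greaterThanLessThan_iff subsetI)
  define U where "U = S \<inter> ball x r"
  have "U = S \<inter> cball x r"
    using r(3) by (auto simp: U_def less_le)
  then have "closedin (top_of_set S) U"
    by (auto intro: closedin_closed_Int)
  moreover have "openin (top_of_set S) U"
    by (auto simp: U_def intro: openin_open_Int)
  moreover have "x \<in> U"
    using W r(1) openin_subset[of "top_of_set S" W] by (auto simp: U_def)
  moreover have "U \<subseteq> W"
    using \<epsilon>(2) r(2) by (auto simp: U_def dist_commute)
  ultimately show "\<exists>U V. openin (top_of_set S) U \<and>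
      (closedin (top_of_set S) V \<and> openin (top_of_set S) V) \<and> x \<in> U \<and> U \<subseteq> V \<and> V \<subseteq> W"
    by blast
qed

lemma compact_injective_imp_embedding_map:
  fixes f :: "'a::topological_space \<Rightarrow> 'b::metric_space"
  assumes "compact S" "continuous_on S f" "inj_on f S" "f ` S \<subseteq> T"
  shows "embedding_map (top_of_set S) (top_of_set T) f"
proof (rule injective_closed_imp_embedding_map)
  show cont: "continuous_map (top_of_set S) (top_of_set T) f"
    using assms by auto
  show "closed_map (top_of_set S) (top_of_set T) f"
    using assms(1) cont
    by (intro continuous_imp_closed_map_gen Hausdorff_imp_kc_space Hausdorff_space_subtopology)
      (auto simp: compact_space_subtopology)
qed (use assms in auto)

section \<open>Short chords with dense ends in the unit sphere\<close>

lemma segment_Int_sphere: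
  assumes "norm e = 1" "m \<bullet> e = 0" "(norm m)\<^sup>2 + a\<^sup>2 = 1" "a > 0"
  shows "segment a m e \<inter> sphere 0 1 = {m + a *\<^sub>R e, m - a *\<^sub>R e}"
proof -
  have ee: "e \<bullet> e = 1"
    using assms(1) by (simp add: norm_eq_1)
  have norm_eq: "(norm (m + s *\<^sub>R e))\<^sup>2 = (norm m)\<^sup>2 + s\<^sup>2" for s
    using ee assms(2) unfolding power2_norm_eq_inner
    by (simp add: inner_add_left inner_add_right inner_commute power2_eq_square)
  have sphere: "m + s *\<^sub>R e \<in> sphere 0 1 \<longleftrightarrow> s = a \<or> s = - a" for s
  proof -
    have "m + s *\<^sub>R e \<in> sphere 0 1 \<longleftrightarrow> (norm (m + s *\<^sub>R e))\<^sup>2 = 1"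
      by (simp add: abs_square_eq_1)
    also have "\<dots> \<longleftrightarrow> s\<^sup>2 = a\<^sup>2"
      using assms(3) norm_eq by auto
    finally show ?thesis
      by (simp add: power2_eq_iff)
  qed
  have segment: "m + s *\<^sub>R e \<in> segment a m e" if "\<bar>s\<bar> \<le> a" for s
    using that ee by (simp add: segment_def offaxis_def)
  show ?thesis
  proof (intro equalityI subsetI)
    fix x assume x: "x \<in> segment a m e \<inter> sphere 0 1"
    define s where "s = (x - m) \<bullet> e"
    have "x = m + s *\<^sub>R e"
      using x by (simp add: s_def segment_def offaxis_def)
    moreover from this have "s = a \<or> s = - a"
      using x sphere[of s] by simp
    ultimately show "x \<in> {m + a *\<^sub>R e, m - a *\<^sub>R e}"
      by auto
  next
    fix x assume "x \<in> {m + a *\<^sub>R e, m - a *\<^sub>R e}"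
    then consider "x = m + a *\<^sub>R e" | "x = m + (- a) *\<^sub>R e"
      by auto
    then show "x \<in> segment a m e \<inter> sphere 0 1"
    proof cases
      case 1
      then show ?thesis
        using segment[of a] sphere[of a] assms(4) by simp
    next
      case 2
      then show ?thesis
        using segment[of "- a"] sphere[of "- a"] assms(4) by simp
    qed
  qed
qed

text \<open>Supplies a second point of the sphere, so that connectedness excludes isolated points
  and countability.\<close>

lemma antipode_neq:
  fixes t :: "'a::real_normed_vector"
  assumes "norm t = 1"
  shows "- t \<noteq> t"
proof
  assume "- t = t"
  then have "2 *\<^sub>R t = 0"
    by (metis add.right_inverse scaleR_2)
  with assms show False
    by simp
qed

text \<open>Orthogonality and the Pythagorean identity put both ends on the unit sphere. The same
  \<open>\<epsilon>\<close> bounds the half-length, for summability, and the distance of one end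
  from the target \<open>t\<close>, for density.\<close>

definition short_chord :: "real \<Rightarrow> real \<Rightarrow> 'a::euclidean_space \<Rightarrow> 'a \<Rightarrow> 'a \<Rightarrow> bool" where
  "short_chord \<epsilon> a m e t \<longleftrightarrow> 0 < a \<and> a \<le> \<epsilon> \<and> norm e = 1 \<and> m \<bullet> e = 0 \<and>
     (norm m)\<^sup>2 + a\<^sup>2 = 1 \<and> dist (m + a *\<^sub>R e) t < \<epsilon>"

text \<open>The sphere has no isolated points, so some point \<open>p\<close> of it near
  \<open>t\<close> avoids \<open>F\<close>. A tiny chord perpendicular to the radius through
  \<open>p\<close> then stays, with its ball, in a neighbourhood of \<open>p\<close> missing
  \<open>F\<close>.\<close>

lemma short_chord_exists:
  fixes t :: "'a::euclidean_space"
  assumes "2 \<le> DIM('a)" "t \<in> sphere 0 1" "\<epsilon> > 0" "closed F" "finite (F \<inter> sphere 0 1)"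
  shows "\<exists>a m e. short_chord \<epsilon> a m e t \<and> cball m (3 * a) \<inter> F = {}"
proof -
  have "connectedin euclidean (sphere (0 :: 'a) 1)"
    using assms(1) by (simp add: connected_sphere_eq)
  moreover have "- t \<in> sphere 0 1" "- t \<noteq> t"
    using assms(2) antipode_neq[of t] by auto
  then have "\<nexists>b. sphere (0 :: 'a) 1 = {b}"
    using assms(2) by (metis singletonD)
  ultimately have "sphere (0 :: 'a) 1 \<subseteq> euclidean derived_set_of sphere 0 1"
    by (intro connectedin_imp_perfect_gen) (auto intro: Hausdorff_imp_t1_space)
  then have "t \<in> euclidean derived_set_of sphere 0 1"
    using assms(2) by blast
  then have "t islimpt sphere 0 1"
    unfolding in_derived_set_of islimpt_def open_openin[symmetric] by blast
  then have "infinite (sphere 0 1 \<inter> ball t (\<epsilon> / 2))"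
    using assms(3) by (simp add: islimpt_eq_infinite_ball)
  then have "\<not> sphere 0 1 \<inter> ball t (\<epsilon> / 2) \<subseteq> F \<inter> sphere 0 1"
    using assms(5) finite_subset by blast
  then obtain p where "p \<in> sphere 0 1" "p \<in> ball t (\<epsilon> / 2)" "p \<notin> F"
    by blast
  then have p: "norm p = 1" "dist t p < \<epsilon> / 2" "p \<notin> F"
    by simp_all
  then obtain \<delta> where \<delta>: "\<delta> > 0" "ball p \<delta> \<subseteq> - F"
    using assms(4) open_contains_ball[of "- F"] by auto
  obtain y where y: "y \<noteq> 0" "orthogonal p y"
    using orthogonal_to_vector_exists[OF assms(1)] by blast
  define e where "e = y /\<^sub>R norm y"
  have e: "norm e = 1" "p \<bullet> e = 0"
    using y by (auto simp: e_def orthogonal_def)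
  \<comment> \<open>The end of the chord is within \<open>a + a + \<epsilon> / 2\<close> of
    \<open>t\<close>, and the ball of radius \<open>3 * a\<close> about \<open>m\<close> stays
    within \<open>4 * a\<close> of \<open>p\<close>; the fifths make both strict. The bound
    \<open>1 / 2\<close> keeps \<open>1 - a\<^sup>2\<close> positive.\<close>
  define a where "a = min (1 / 2) (min (\<epsilon> / 5) (\<delta> / 5))"
  have a: "0 < a" "a < 1" "a \<le> \<epsilon> / 5" "a \<le> \<delta> / 5"
    using assms(3) \<delta>(1) by (auto simp: a_def)
  define c where "c = sqrt (1 - a\<^sup>2)"
  have a2: "a\<^sup>2 \<le> 1"
    using a by (simp add: power_le_one)
  have c: "0 \<le> c" "c \<le> 1" "c\<^sup>2 = 1 - a\<^sup>2"
    using a2 by (auto simp: c_def)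
  \<comment> \<open>Since \<open>c\<close> and \<open>a\<close> are in [0, 1], \<open>c\<close> is
    at least \<open>c\<^sup>2 = 1 - a\<^sup>2\<close>, hence at least \<open>1 - a\<close>. This
    bounds the distance from \<open>m\<close> to \<open>p\<close>.\<close>
  have "1 - a \<le> c"
  proof -
    have "a * a \<le> a * 1"
      using a by (intro mult_left_mono) auto
    moreover have "c * c \<le> 1 * c"
      using c by (intro mult_right_mono) auto
    ultimately show ?thesis
      using c(3) by (simp add: power2_eq_square)
  qed
  define m where "m = c *\<^sub>R p"
  have "m - p = (c - 1) *\<^sub>R p"
    by (simp add: m_def algebra_simps)
  then have mp: "dist m p \<le> a"
    using \<open>1 - a \<le> c\<close> c p by (simp add: dist_norm)
  have "short_chord \<epsilon> a m e t"
    unfolding short_chord_def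
  proof (intro conjI)
    show "(norm m)\<^sup>2 + a\<^sup>2 = 1"
      using c p by (simp add: m_def)
    have "dist (m + a *\<^sub>R e) m = a"
      using a e by (simp add: dist_norm)
    then show "dist (m + a *\<^sub>R e) t < \<epsilon>"
      using dist_triangle[of "m + a *\<^sub>R e" t m] dist_triangle[of m t p] mp p(2) a assms(3)
      by (simp add: dist_commute)
  qed (use a e assms(3) in \<open>auto simp: m_def\<close>)
  moreover have "cball m (3 * a) \<subseteq> ball p \<delta>"
  proof
    fix x assume "x \<in> cball m (3 * a)"
    then show "x \<in> ball p \<delta>"
      using dist_triangle[of p x m] mp a by (simp add: dist_commute)
  qed
  ultimately show ?thesis
    using \<delta>(2) by blast
qed

lemma dense_chord_sequence_exists:
  assumes "2 \<le> DIM('a::euclidean_space)"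
  shows "\<exists>a m e :: nat \<Rightarrow> 'a. pinch_sequence a m e \<and>
    (\<forall>i. segment (a i) (m i) (e i) \<inter> sphere 0 1 = {m i + a i *\<^sub>R e i, m i - a i *\<^sub>R e i}) \<and>
    sphere 0 1 \<subseteq> closure (range (\<lambda>i. m i + a i *\<^sub>R e i))"
proof -
  obtain D :: "'a set" where D: "countable D" "D \<subseteq> sphere 0 1" "sphere 0 1 \<subseteq> closure D"
    using separable .
  have "sphere (0 :: 'a) 1 \<noteq> {}"
    by simp
  with D have "D \<noteq> {}"
    by auto
  \<comment> \<open>Decoding \<open>i\<close> as a pair makes every point of \<open>D\<close> a
    target infinitely often, hence also at arbitrarily small tolerances.\<close>
  define t where "t i = from_nat_into D (fst (prod_decode i))" for i
  have t: "t i \<in> sphere 0 1" for i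
    unfolding t_def using D(2) from_nat_into[OF \<open>D \<noteq> {}\<close>] by blast
  define P where "P f i q \<longleftrightarrow> (case q of (a, m, e) \<Rightarrow> short_chord ((1 / 6) ^ Suc i) a m e (t i) \<and>
      (\<forall>j<i. case f j of (b, l, d) \<Rightarrow> cball m (3 * a) \<inter> segment b l d = {}))"
    for f :: "nat \<Rightarrow> real \<times> 'a \<times> 'a" and i q
  have "\<exists>f. \<forall>i. P f i (f i)"
  proof (rule dependent_wellorder_choice)
    show "P f i q = P g i q" if "\<And>j. j < i \<Longrightarrow> f j = g j" for q f g i
      using that by (auto simp: P_def)
  next
    fix i f
    assume P: "P f j (f j)" if "j < i" for j
    define F where "F = (\<Union>j<i. case f j of (b, l, d) \<Rightarrow> segment b l d)"
    have "closed F"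
      unfolding F_def by (intro closed_UN) (auto simp: segment_closed split: prod.splits)
    \<comment> \<open>Earlier chords meet the sphere only in their ends, so they leave room for the
      next one.\<close>
    moreover have "finite (F \<inter> sphere 0 1)"
    proof -
      have "finite ((case f j of (b, l, d) \<Rightarrow> segment b l d) \<inter> sphere 0 1)" if "j < i" for j
        using P[OF that] by (auto simp: P_def short_chord_def segment_Int_sphere split: prod.splits)
      then have "finite (\<Union>j<i. (case f j of (b, l, d) \<Rightarrow> segment b l d) \<inter> sphere 0 1)"
        by blast
      then show ?thesis
        by (simp add: F_def Int_UN_distrib2)
    qed
    ultimately obtain a m e where
      "short_chord ((1 / 6) ^ Suc i) a m e (t i)" "cball m (3 * a) \<inter> F = {}"
      using short_chord_exists[OF assms t, of "(1 / 6) ^ Suc i" F i] by auto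
    then have "P f i (a, m, e)"
      unfolding P_def F_def by (force split: prod.splits)
    then show "\<exists>q. P f i q"
      by blast
  qed
  then obtain f where f: "\<And>i. P f i (f i)"
    by blast
  define a m e where "a i = fst (f i)" and "m i = fst (snd (f i))" and "e i = snd (snd (f i))" for i
  have chord: "short_chord ((1 / 6) ^ Suc i) (a i) (m i) (e i) (t i)" for i
    using f[of i] by (simp add: P_def a_def m_def e_def case_prod_beta)
  have disj: "cball (m i) (3 * a i) \<inter> segment (a j) (m j) (e j) = {}" if "j < i" for i j
    using f[of i] that by (simp add: P_def a_def m_def e_def case_prod_beta)
  have "pinch_sequence a m e"
    using chord disj by unfold_locales (auto simp: short_chord_def)
  moreover have "segment (a i) (m i) (e i) \<inter> sphere 0 1 = {m i + a i *\<^sub>R e i, m i - a i *\<^sub>R e i}" for i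
    using chord[of i] by (intro segment_Int_sphere) (auto simp: short_chord_def)
  moreover have "x \<in> closure (range (\<lambda>i. m i + a i *\<^sub>R e i))" if x: "x \<in> sphere 0 1" for x
    unfolding closure_approachable
  proof (intro allI impI)
    fix \<epsilon> :: real assume "\<epsilon> > 0"
    then obtain d where "d \<in> D" "dist d x < \<epsilon> / 2"
      using D(3) x closure_approachable[of x D] half_gt_zero by blast
    then obtain k where k: "dist (from_nat_into D k) x < \<epsilon> / 2"
      using from_nat_into_surj[OF D(1)] by metis
    obtain n where n: "(1 / 6) ^ n < \<epsilon> / 2"
      using real_arch_pow_inv[of "\<epsilon> / 2" "1 / 6"] \<open>\<epsilon> > 0\<close> by auto
    \<comment> \<open>This index has target number \<open>k\<close> and is at least
      \<open>n\<close>, so its tolerance is at most \<open>(1 / 6) ^ n\<close>.\<close>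
    define i where "i = prod_encode (k, n)"
    have "(1 / 6 :: real) ^ Suc i \<le> (1 / 6) ^ n"
      using le_prod_encode_2[of n k] by (intro power_decreasing) (auto simp: i_def)
    moreover have "dist (t i) x < \<epsilon> / 2"
      using k by (simp add: t_def i_def)
    moreover have "dist (m i + a i *\<^sub>R e i) (t i) < (1 / 6) ^ Suc i"
      using chord[of i] by (simp only: short_chord_def)
    ultimately have "dist (m i + a i *\<^sub>R e i) x < \<epsilon>"
      using n dist_triangle[of "m i + a i *\<^sub>R e i" x "t i"] by linarith
    then show "\<exists>y\<in>range (\<lambda>i. m i + a i *\<^sub>R e i). dist y x < \<epsilon>"
      by blast
  qed
  ultimately show ?thesis
    by blast
qed

section \<open>The singular set and the map between spheres\<close>

text \<open>Injectivity of \<open>\<psi>\<close> leaves the fibres unchanged. The two ends of a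
  chord are distinct points of \<open>S\<close>, so each of them has a partner inside
  \<open>S\<close>.\<close>

lemma (in pinch_sequence) singular_set_limit_map:
  assumes "inj \<psi>" "\<And>i. chord i \<inter> S = {m i + a i *\<^sub>R e i, m i - a i *\<^sub>R e i}"
  shows "singular_set S (\<psi> \<circ> limit_map 0) = (\<Union>i. chord i \<inter> S)"
proof -
  have ne: "m i + a i *\<^sub>R e i \<noteq> m i - a i *\<^sub>R e i" for i
  proof
    assume "m i + a i *\<^sub>R e i = m i - a i *\<^sub>R e i"
    then have "(2 * a i) *\<^sub>R e i = 0"
      by (simp add: algebra_simps flip: scaleR_2)
    then show False
      using radius_pos[of i] norm_axis[of i] by auto
  qed
  have other: "\<exists>y \<in> chord i \<inter> S. y \<noteq> x" for x i
    using ne[of i] unfolding assms(2) by auto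
  have eq: "(\<psi> \<circ> limit_map 0) y = (\<psi> \<circ> limit_map 0) x \<longleftrightarrow> y = x \<or> (\<exists>j. y \<in> chord j \<and> x \<in> chord j)" for x y
    using assms(1) by (simp add: inj_eq limit_map_eq_iff)
  show ?thesis
  proof (intro equalityI subsetI)
    fix x assume "x \<in> singular_set S (\<psi> \<circ> limit_map 0)"
    then have "x \<in> S" "S \<inter> (\<psi> \<circ> limit_map 0) -` {(\<psi> \<circ> limit_map 0) x} \<noteq> {x}"
      by (simp_all add: singular_set_def)
    then obtain y where "y \<noteq> x" "(\<psi> \<circ> limit_map 0) y = (\<psi> \<circ> limit_map 0) x"
      by blast
    then show "x \<in> (\<Union>i. chord i \<inter> S)"
      using \<open>x \<in> S\<close> unfolding eq by blast
  next
    fix x assume "x \<in> (\<Union>i. chord i \<inter> S)"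
    then obtain i where x: "x \<in> S" "x \<in> chord i"
      by blast
    then obtain y where y: "y \<in> S" "y \<in> chord i" "y \<noteq> x"
      using other[of i x] by blast
    then have "(\<psi> \<circ> limit_map 0) y = (\<psi> \<circ> limit_map 0) x"
      using x unfolding eq by blast
    with x y show "x \<in> singular_set S (\<psi> \<circ> limit_map 0)"
      unfolding singular_set_def by blast
  qed
qed

theorem theorem1p2:
  fixes n :: nat
  assumes "n \<ge> 3" and "CARD('m::finite) = n" and "CARD('k::finite) = n + 1"
  shows "\<exists>f :: real ^ 'm \<Rightarrow> real ^ 'k.
    continuous_map (top_of_set (sphere 0 1)) (top_of_set (sphere 0 1)) f \<and>
    (countable (singular_set (sphere 0 1) f) \<and>
     top_of_set (sphere 0 1) closure_of singular_set (sphere 0 1) f = sphere 0 1 \<and>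
     top_of_set (singular_set (sphere 0 1) f) dim_le 0 \<and>
     \<not> top_of_set (singular_set (sphere 0 1) f) dim_le (-1) \<and>
     \<not> closedin (top_of_set (sphere 0 1)) (singular_set (sphere 0 1) f)) \<and>
    (\<forall>\<epsilon>>0. \<exists>g :: real ^ 'm \<Rightarrow> real ^ 'k.
       embedding_map (top_of_set (sphere 0 1)) (top_of_set (sphere 0 1)) g \<and>
       (\<forall>x \<in> sphere 0 1. dist (f x) (g x) < \<epsilon>))"
proof -
  let ?S = "sphere 0 1 :: (real ^ 'm) set"
  have DIM: "2 \<le> DIM(real ^ 'm)"
    using assms by simp
  obtain b :: "real ^ 'k" where b: "b \<in> sphere 0 1"
    by (meson equals0I sphere_eq_empty zero_le_one not_le)
  have "(sphere 0 1 - {b}) homeomorphic (UNIV :: (real ^ 'm) set)"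
    using b assms by (intro homeomorphic_punctured_sphere_affine) auto
  then obtain \<psi> :: "real ^ 'm \<Rightarrow> real ^ 'k" and \<psi>'
    where hom: "homeomorphism UNIV (sphere 0 1 - {b}) \<psi> \<psi>'"
    unfolding homeomorphic_def using homeomorphism_symD by blast
  have \<psi>_cont: "continuous_on UNIV \<psi>" and \<psi>_sphere: "\<psi> x \<in> sphere 0 1" for x
    using hom unfolding homeomorphism_def by blast+
  have \<psi>_inj: "inj \<psi>"
    using hom by (metis homeomorphism_apply1 inj_on_inverseI)
  obtain a m and e :: "nat \<Rightarrow> real ^ 'm" where "pinch_sequence a m e"
    and ends: "\<And>i. segment (a i) (m i) (e i) \<inter> ?S = {m i + a i *\<^sub>R e i, m i - a i *\<^sub>R e i}"
    and dense: "?S \<subseteq> closure (range (\<lambda>i. m i + a i *\<^sub>R e i))"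
    using dense_chord_sequence_exists[OF DIM] by blast
  then interpret pinch_sequence a m e
    by simp
  let ?f = "\<psi> \<circ> limit_map 0" and ?\<Sigma> = "\<Union>i. chord i \<inter> ?S"
  have sing: "singular_set ?S ?f = ?\<Sigma>"
    using \<psi>_inj ends by (rule singular_set_limit_map)
  have f_cont: "continuous_map (top_of_set ?S) (top_of_set (sphere 0 1)) ?f"
  proof -
    have "continuous_on ?S ?f"
      by (intro continuous_on_compose limit_map_continuous continuous_on_subset[OF \<psi>_cont]) auto
    with \<psi>_sphere show ?thesis
      by auto
  qed
  have countable: "countable ?\<Sigma>"
    using ends by simp
  have sub: "range (\<lambda>i. m i + a i *\<^sub>R e i) \<subseteq> ?\<Sigma>"
    using ends by blast
  have closure: "top_of_set ?S closure_of ?\<Sigma> = ?S"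
  proof -
    have "?S \<inter> ?\<Sigma> = ?\<Sigma>"
      by blast
    then show ?thesis
      using order_trans[OF dense closure_mono[OF sub]]
      by (simp only: closure_of_subtopology euclidean_closure_of) blast
  qed
  \<comment> \<open>A closed dense subset would be the whole sphere, which is uncountable.\<close>
  have not_closed: "\<not> closedin (top_of_set ?S) ?\<Sigma>"
  proof
    assume "closedin (top_of_set ?S) ?\<Sigma>"
    from trans[OF closure_of_closedin[OF this, symmetric] closure] have "?\<Sigma> = ?S" .
    moreover have "uncountable ?S"
    proof -
      obtain u :: "real ^ 'm" where u: "u \<in> ?S"
        by (meson equals0I sphere_eq_empty zero_le_one not_le)
      have "connected ?S"
        using DIM by (simp add: connected_sphere_eq)
      moreover have "- u \<in> ?S" "- u \<noteq> u"
        using u antipode_neq[of u] by auto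
      ultimately show ?thesis
        using u connected_uncountable by blast
    qed
    ultimately show False
      using countable by simp
  qed
  have "\<exists>g. embedding_map (top_of_set ?S) (top_of_set (sphere 0 1)) g \<and>
      (\<forall>x \<in> ?S. dist (?f x) (g x) < \<epsilon>)" if pos: "\<epsilon> > 0" for \<epsilon>
  proof -
    \<comment> \<open>\<open>limit_map 0\<close> moves points by at most 1, so it sends the sphere
      into the ball of radius 2, and \<open>g\<close> stays within 1 of it. On the compact ball of
      radius 3 the continuous \<open>\<psi>\<close> is uniformly continuous.\<close>
    have "uniformly_continuous_on (cball 0 3) \<psi>"
      using \<psi>_cont by (intro compact_uniformly_continuous) (auto intro: continuous_on_subset)
    then obtain \<delta> where \<delta>: "\<delta> > 0"
      "\<And>x y. x \<in> cball 0 3 \<Longrightarrow> y \<in> cball 0 3 \<Longrightarrow> dist y x < \<delta> \<Longrightarrow> dist (\<psi> y) (\<psi> x) < \<epsilon>"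
      using pos unfolding uniformly_continuous_on_def by metis
    obtain g where g: "continuous_on UNIV g" "inj g" "\<And>x. dist (limit_map 0 x) (g x) < min \<delta> 1"
      using limit_map_injective_approx[of "min \<delta> 1"] \<delta>(1) by auto
    have "dist (?f x) ((\<psi> \<circ> g) x) < \<epsilon>" if "x \<in> ?S" for x
    proof -
      have "dist 0 (limit_map 0 x) \<le> 2"
        using that dist_stage_limit_map[of 0 0 x] dist_triangle[of 0 "limit_map 0 x" x] by simp
      moreover have "dist 0 (g x) \<le> dist 0 (limit_map 0 x) + dist (limit_map 0 x) (g x)"
        by (rule dist_triangle)
      ultimately show ?thesis
        using g(3)[of x] \<delta>(2)[of "g x" "limit_map 0 x"] unfolding mem_cball by simp
    qed
    moreover have "embedding_map (top_of_set ?S) (top_of_set (sphere 0 1)) (\<psi> \<circ> g)"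
    proof (rule compact_injective_imp_embedding_map)
      show "continuous_on ?S (\<psi> \<circ> g)"
        by (intro continuous_on_compose continuous_on_subset[OF g(1)] continuous_on_subset[OF \<psi>_cont]) auto
      show "inj_on (\<psi> \<circ> g) ?S"
        using inj_compose[OF \<psi>_inj g(2)] by (rule inj_on_subset) simp
    qed (use \<psi>_sphere in auto)
    ultimately show ?thesis
      by blast
  qed
  moreover have "\<not> top_of_set ?\<Sigma> dim_le (-1)"
    using sub by (auto simp: subtopology_trivial_iff)
  ultimately show ?thesis
    using f_cont countable closure countable_imp_dim_le_0[OF countable] not_closed
    by (intro exI[of _ ?f]) (simp only: sing, blast)
qed

end
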